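(* Let $N\in\mathbb{N}$, let $I$ be a non-empty set, let $\mathfrak{d}=(\mathfrak{d}_1,\ldots,\mathfrak{d}_N)\colon I\to\mathbb{N}^N$ be an $N$-fold dimension mapping on $I$, let $\lambda,c\in\mathbb{R}$, $a\in C(\mathbb{R},\mathbb{R})$, $(\mathfrak{i}_d)_{d\in\mathbb{N}}\subseteq\mathbb{N}$, $(\Psi_d)_{d\in\mathbb{N}}\subseteq\mathscr{N}$ satisfy for all $d\in\mathbb{N}$ that $\mathcal{R}_a(\Psi_d)=\mathrm{id}_{\mathbb{R}^d}$, $\mathcal{D}(\Psi_d)=(d,\mathfrak{i}_d,d)$, and $\mathfrak{i}_d\le cd$, let $\mathfrak{w}\colon[0,\infty)\to[0,\infty)$, $\mathfrak{I}\colon I\to\mathbb{N}$, and $\mathfrak{O}\colon I\to\mathbb{N}$ be functions, and let $f=(f_i)_{i\in I}$, $g=(g_i)_{i\in I}\in\mathbb{W}_{a,\mathfrak{w}}(I,\mathfrak{d})$ satisfy for all $i\in I$ that $\{f_i,g_i\}\subseteq C(\mathbb{R}^{\mathfrak{I}(i)},\mathbb{R}^{\mathfrak{O}(i)})$. Then $$\Big(I\ni i\mapsto(\lambda f_i+g_i)\in\textstyle\bigcup_{k,l\in\mathbb{N}}C(\mathbb{R}^k,\mathbb{R}^l)\Big)\in\mathbb{W}_{a,\mathfrak{w}}(I,\mathfrak{d}).$$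
   Context: $\mathbb{N}=\{1,2,3,\ldots\}$ and $\|\cdot\|$ is the Euclidean norm on every $\mathbb{R}^d$. ANNs: $\mathscr{N} = \bigcup_{L\in\mathbb{N}}\bigcup_{l_0,\ldots,l_L\in\mathbb{N}} \left(\times_{k=1}^L (\mathbb{R}^{l_k\times l_{k-1}}\times\mathbb{R}^{l_k})\right)$. For $\Phi=((W_1,B_1),\ldots,(W_L,B_L)) \in \times_{k=1}^L (\mathbb{R}^{l_k\times l_{k-1}}\times\mathbb{R}^{l_k})$: $\mathcal{D}(\Phi)=(l_0,l_1,\ldots,l_L)$, $\mathcal{P}(\Phi)=\sum_{k=1}^L l_k(l_{k-1}+1)$, and for $a\in C(\mathbb{R},\mathbb{R})$ the realization $\mathcal{R}_a(\Phi)\in C(\mathbb{R}^{l_0},\mathbb{R}^{l_L})$ is $(\mathcal{R}_a(\Phi))(x_0)=W_Lx_{L-1}+B_L$, where for $0<k<L$ the vector $x_k$ is obtained by applying $a$ componentwise to $W_kx_{k-1}+B_k$. A function family on a non-empty set $I$ is a map $f=(f_i)_{i\in I}\colon I\to\bigcup_{k,l\in\mathbb{N}}C(\mathbb{R}^k,\mathbb{R}^l)$. An $N$-fold dimension mapping on $I$ is a function $\mathfrak{d}=(\mathfrak{d}_1,\ldots,\mathfrak{d}_N)\colon I\to\mathbb{N}^N$. Approximation spaces: for $r_0,\ldots,r_N\in\mathbb{R}$, $a\in C(\mathbb{R},\mathbb{R})$ and $\mathfrak{w}\colon[0,\infty)\to[0,\infty)$, the set $\mathcal{W}_{a,\mathfrak{w},\infty,\infty}^{r_0,r_1,\ldots,r_N}(I,\mathfrak{d})$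 consists of all function families $f=(f_i)_{i\in I}$ on $I$ for which there exists $K\in\mathbb{R}$ such that for all $i\in I$, $\varepsilon\in(0,1]$ there exist $\Phi\in\mathscr{N}$ and $m,n\in\mathbb{N}$ with $\{f_i,\mathcal{R}_a(\Phi)\}\subseteq C(\mathbb{R}^m,\mathbb{R}^n)$, $\mathcal{P}(\Phi)\le K\varepsilon^{-r_0}\prod_{l=1}^N|\mathfrak{d}_l(i)|^{r_l}$, and $\sup_{x\in\mathbb{R}^m}\big(\mathfrak{w}(\|x\|)\|f_i(x)-(\mathcal{R}_a(\Phi))(x)\|\big)\le\varepsilon$. Moreover, $\mathbb{W}_{a,\mathfrak{w}}(I,\mathfrak{d})=\bigcup_{r_0,r_1,\ldots,r_N\in\mathbb{R}}\mathcal{W}_{a,\mathfrak{w},\infty,\infty}^{r_0,r_1,\ldots,r_N}(I,\mathfrak{d})$. *)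

theory Defs
  imports Complex_Main "HOL-Analysis.L2_Norm" "HOL-Library.Extended_Real"
    "Jordan_Normal_Form.Matrix"
begin

text \<open>
  The space $R^d$ is \<open>carrier_vec d :: real vec set\<close>. A function $R^k \to R^l$ is a partial map on
  \<open>real vec\<close> whose domain is exactly \<open>carrier_vec k\<close>. A total function on \<open>real vec\<close> would not
  determine \<open>k\<close>, and the condition $\{f_i, R_a(\Phi)\} \subseteq C(R^m,R^n)$ below relies on
  functions determining their domains.
\<close>

definition vnorm :: "real vec \<Rightarrow> real" where
  "vnorm x = L2_set (\<lambda>i. x $ i) {..<dim_vec x}"

type_synonym vfun = "real vec \<Rightarrow> real vec option"

definition cont_funs :: "nat \<Rightarrow> nat \<Rightarrow> vfun set" where
  "cont_funs k l = {f. dom f = carrier_vec k \<and> ran f \<subseteq> carrier_vec l \<and>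
     (\<forall>x\<in>carrier_vec k. \<forall>e>0. \<exists>\<delta>>0. \<forall>y\<in>carrier_vec k.
        vnorm (y - x) < \<delta> \<longrightarrow> vnorm (the (f y) - the (f x)) < e)}"

definition vfun_id :: "nat \<Rightarrow> vfun" where
  "vfun_id d = Some |` carrier_vec d"

definition vfun_scale :: "real \<Rightarrow> vfun \<Rightarrow> vfun" where
  "vfun_scale c f = (\<lambda>x. map_option (\<lambda>v. c \<cdot>\<^sub>v v) (f x))"

definition vfun_add :: "vfun \<Rightarrow> vfun \<Rightarrow> vfun" where
  "vfun_add f g = (\<lambda>x. case (f x, g x) of (Some u, Some v) \<Rightarrow> Some (u + v) | _ \<Rightarrow> None)"

type_synonym ann = "(real mat \<times> real vec) list"

text \<open>The layer $(W_{k+1}, B_{k+1})$ is the list entry at position \<open>k\<close>.\<close>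

definition ANN :: "ann set" where
  "ANN = (\<Union>L\<in>{1..}. \<Union>l\<in>{l :: nat \<Rightarrow> nat. \<forall>k\<le>L. 1 \<le> l k}.
     {\<Phi>. length \<Phi> = L \<and>
        (\<forall>k<L. \<Phi> ! k \<in> carrier_mat (l (Suc k)) (l k) \<times> carrier_vec (l (Suc k)))})"

definition ann_dims :: "ann \<Rightarrow> nat list" where
  "ann_dims \<Phi> = dim_col (fst (hd \<Phi>)) # map (\<lambda>(W, B). dim_row W) \<Phi>"

definition ann_params :: "ann \<Rightarrow> nat" where
  "ann_params \<Phi> = (\<Sum>(W, B)\<leftarrow>\<Phi>. dim_row W * (dim_col W + 1))"

text \<open>The activation is not applied in the last layer; the empty list is not in \<open>ANN\<close>.\<close>

fun ann_eval :: "(real \<Rightarrow> real) \<Rightarrow> ann \<Rightarrow> real vec \<Rightarrow> real vec" where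
  "ann_eval a [] x = x"
| "ann_eval a [(W, B)] x = W *\<^sub>v x + B"
| "ann_eval a ((W, B) # \<phi> # \<Phi>) x = ann_eval a (\<phi> # \<Phi>) (map_vec a (W *\<^sub>v x + B))"

definition realization :: "(real \<Rightarrow> real) \<Rightarrow> ann \<Rightarrow> vfun" where
  "realization a \<Phi> = (Some \<circ> ann_eval a \<Phi>) |` carrier_vec (hd (ann_dims \<Phi>))"

text \<open>Values of a family outside the index set are irrelevant throughout.\<close>

definition function_families :: "'i set \<Rightarrow> ('i \<Rightarrow> vfun) set" where
  "function_families I = I \<rightarrow> (\<Union>k\<in>{1..}. \<Union>l\<in>{1..}. cont_funs k l)"

text \<open>
  \<open>\<dd> i l\<close> is $d_l(i)$ for $1 \le l \le N$, and the exponents are $r_0, \ldots, r_N$; values at other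
  indices do not matter. The supremum is taken in the extended reals, so that an unbounded
  weighted error is $\infty$.
\<close>

definition approx_space ::
  "(real \<Rightarrow> real) \<Rightarrow> (real \<Rightarrow> real) \<Rightarrow> nat \<Rightarrow> (nat \<Rightarrow> real) \<Rightarrow> 'i set \<Rightarrow> ('i \<Rightarrow> nat \<Rightarrow> nat) \<Rightarrow> ('i \<Rightarrow> vfun) set"
  where
  "approx_space a w N r I \<dd> = {f \<in> function_families I.
     \<exists>K :: real. \<forall>i\<in>I. \<forall>\<epsilon>\<in>{0<..1}. \<exists>\<Phi>\<in>ANN. \<exists>m\<ge>1. \<exists>n\<ge>1.
       {f i, realization a \<Phi>} \<subseteq> cont_funs m n \<and>
       real (ann_params \<Phi>) \<le> K * \<epsilon> powr (- r 0) * (\<Prod>l=1..N. \<bar>real (\<dd> i l)\<bar> powr r l) \<and>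
       (SUP x\<in>carrier_vec m. ereal (w (vnorm x) * vnorm (the (f i x) - the (realization a \<Phi> x))))
         \<le> ereal \<epsilon>}"

definition approx_union ::
  "(real \<Rightarrow> real) \<Rightarrow> (real \<Rightarrow> real) \<Rightarrow> nat \<Rightarrow> 'i set \<Rightarrow> ('i \<Rightarrow> nat \<Rightarrow> nat) \<Rightarrow> ('i \<Rightarrow> vfun) set"
  where
  "approx_union a w N I \<dd> = (\<Union>r. approx_space a w N r I \<dd>)"

end

theory Submission imports Defs begin

text \<open>
  Append copies of the identity network to the shallower of two approximating networks until the
  depths agree, run both in parallel on a duplicated input, and combine the outputs in the last
  layer. All widths stay below \<open>C * P\<close> and \<open>C * Q\<close>, where \<open>P, Q\<close> are the parameter counts,
  so the result has at most \<open>16 * C\<^sup>2 * (P * Q)\<^sup>3\<close> parameters. Because \<open>P, Q \<ge> 1\<close>, bounding the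
  sum \<open>P + Q\<close> by the product \<open>2 * P * Q\<close> lets the exponents of the two families simply add, whatever
  their signs. Both families are approximated to accuracy \<open>\<epsilon> / (\<bar>lam\<bar> + 1)\<close>.
\<close>

text \<open>
  \<open>net M n k \<Phi>\<close>: a well-formed network from $R^k$ to $R^n$ all of whose layer widths are at most
  \<open>M\<close>. Tracking only a common width bound and the depth suffices for polynomial parameter counts.
\<close>

inductive net :: "nat \<Rightarrow> nat \<Rightarrow> nat \<Rightarrow> ann \<Rightarrow> bool" for M n where
  net_single: "\<lbrakk>W \<in> carrier_mat n k; B \<in> carrier_vec n; k \<in> {1..M}; n \<in> {1..M}\<rbrakk>
    \<Longrightarrow> net M n k [(W, B)]"
| net_cons: "\<lbrakk>W \<in> carrier_mat j k; B \<in> carrier_vec j; k \<in> {1..M}; net M n j \<Phi>\<rbrakk>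
    \<Longrightarrow> net M n k ((W, B) # \<Phi>)"

section \<open>Elementary bounds for width-bounded networks\<close>

lemma net_bounds: "net M n k \<Phi> \<Longrightarrow> k \<in> {1..M} \<and> n \<in> {1..M} \<and> \<Phi> \<noteq> []"
  by (induction rule: net.induct) auto

lemma net_mono: "net M n k \<Phi> \<Longrightarrow> M \<le> M' \<Longrightarrow> net M' n k \<Phi>"
  by (induction rule: net.induct) (auto intro: net.intros)

lemma net_input_dim: "net M n k \<Phi> \<Longrightarrow> hd (ann_dims \<Phi>) = k"
  by (induction rule: net.induct) (auto simp: ann_dims_def)

text \<open>A layer with \<open>j\<close> rows and \<open>k\<close> columns has
  \<open>j * (k + 1)\<close> parameters, and both dimensions are at most \<open>M\<close>.\<close>

lemma net_params: "net M n k \<Phi> \<Longrightarrow> ann_params \<Phi> \<le> length \<Phi> * (M * (M + 1))"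
proof (induction rule: net.induct)
  case (net_single W k B)
  then have "n * (k + 1) \<le> M * (M + 1)" by (intro mult_le_mono) auto
  with net_single show ?case by (auto simp: ann_params_def)
next
  case (net_cons W j k B \<Phi>)
  then have "j * (k + 1) \<le> M * (M + 1)"
    using net_bounds[OF net_cons.hyps(4)] by (intro mult_le_mono) auto
  with net_cons show ?case by (auto simp: ann_params_def)
qed

section \<open>Translation between \<open>ANN\<close> and \<open>net\<close>\<close>

lemma ANN_iff: "\<Phi> \<in> ANN \<longleftrightarrow> \<Phi> \<noteq> [] \<and> (\<exists>l. (\<forall>k\<le>length \<Phi>. 1 \<le> l k) \<and>
    (\<forall>k<length \<Phi>. \<Phi> ! k \<in> carrier_mat (l (Suc k)) (l k) \<times> carrier_vec (l (Suc k))))"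
  unfolding ANN_def by (cases \<Phi>) auto

lemma net_dims:
  "net M n k \<Phi> \<Longrightarrow> \<exists>l. l 0 = k \<and> (\<forall>i\<le>length \<Phi>. 1 \<le> l i) \<and>
    (\<forall>i<length \<Phi>. \<Phi> ! i \<in> carrier_mat (l (Suc i)) (l i) \<times> carrier_vec (l (Suc i)))"
proof (induction rule: net.induct)
  case (net_single W k B)
  then show ?case by (intro exI[of _ "\<lambda>i. if i = 0 then k else n"]) (auto simp: le_Suc_eq)
next
  case (net_cons W j k B \<Phi>)
  then obtain l where l: "l 0 = j" "\<forall>i\<le>length \<Phi>. 1 \<le> l i"
    "\<forall>i<length \<Phi>. \<Phi> ! i \<in> carrier_mat (l (Suc i)) (l i) \<times> carrier_vec (l (Suc i))"
    by auto
  \<comment> \<open>Prepending a layer shifts the width sequence by one place and puts the new input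
    width \<open>k\<close> in front.\<close>
  show ?case
    using l net_cons.hyps
    by (intro exI[of _ "case_nat k l"]) (auto simp: less_Suc_eq_0_disj split: nat.split)
qed

lemma net_ANN: "net M n k \<Phi> \<Longrightarrow> \<Phi> \<in> ANN"
  using net_dims[of M n k \<Phi>] net_bounds[of M n k \<Phi>] unfolding ANN_iff by blast

text \<open>Counterpart of \<open>net_dims\<close>: the width function that \<open>ANN\<close>
  provides is turned into a derivation of \<open>net\<close> by peeling off the first layer and
  shifting \<open>l\<close>.\<close>

lemma net_of_dims:
  assumes "\<Phi> \<noteq> []" "\<forall>i\<le>length \<Phi>. l i \<in> {1..M}"
    "\<forall>i<length \<Phi>. \<Phi> ! i \<in> carrier_mat (l (Suc i)) (l i) \<times> carrier_vec (l (Suc i))"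
  shows "net M (l (length \<Phi>)) (l 0) \<Phi>"
  using assms
proof (induction \<Phi> arbitrary: l)
  case (Cons p \<Phi>)
  obtain W B where p: "p = (W, B)" by (cases p)
  have WB: "W \<in> carrier_mat (l 1) (l 0)" "B \<in> carrier_vec (l 1)"
    using Cons.prems(3)[rule_format, of 0] by (auto simp: p)
  show ?case
  proof (cases "\<Phi> = []")
    case True
    then show ?thesis using WB Cons.prems(2) by (auto simp: p intro!: net_single)
  next
    case False
    have 1: "\<forall>i\<le>length \<Phi>. l (Suc i) \<in> {1..M}" using Cons.prems(2) by auto
    have "net M (l (Suc (length \<Phi>))) (l (Suc 0)) \<Phi>"
      using Cons.prems(3) by (intro Cons.IH[of "\<lambda>i. l (Suc i)", OF False 1]) auto
    then show ?thesis using WB Cons.prems(2) by (auto simp: p intro!: net_cons)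
  qed
qed simp

text \<open>Widths are positive, so a layer with \<open>r\<close> rows and \<open>s\<close> columns
  contributes \<open>r * (s + 1)\<close>, which dominates \<open>r\<close>, \<open>s\<close> and 1.
  The ones add up to the depth.\<close>

lemma ANN_dims_le_params:
  assumes "\<forall>i\<le>length \<Phi>. 1 \<le> l i"
    "\<forall>i<length \<Phi>. \<Phi> ! i \<in> carrier_mat (l (Suc i)) (l i) \<times> carrier_vec (l (Suc i))"
  shows "length \<Phi> \<le> ann_params \<Phi> \<and> (\<forall>i<length \<Phi>. l i \<le> ann_params \<Phi> \<and> l (Suc i) \<le> ann_params \<Phi>)"
  using assms
proof (induction \<Phi> arbitrary: l)
  case (Cons p \<Phi>)
  obtain W B where p: "p = (W, B)" by (cases p)
  have WB: "W \<in> carrier_mat (l 1) (l 0)" "B \<in> carrier_vec (l 1)"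
    using Cons.prems(2)[rule_format, of 0] by (auto simp: p)
  have IH: "length \<Phi> \<le> ann_params \<Phi> \<and>
      (\<forall>i<length \<Phi>. l (Suc i) \<le> ann_params \<Phi> \<and> l (Suc (Suc i)) \<le> ann_params \<Phi>)"
    using Cons.prems by (intro Cons.IH[of "\<lambda>i. l (Suc i)"]) auto
  have eq: "ann_params (p # \<Phi>) = l 1 * (l 0 + 1) + ann_params \<Phi>"
    using WB by (auto simp: ann_params_def p)
  have "1 \<le> l 0" "1 \<le> l 1" using Cons.prems(1) by auto
  then have *: "l 0 \<le> l 1 * (l 0 + 1)" "l 1 \<le> l 1 * (l 0 + 1)" "1 \<le> l 1 * (l 0 + 1)"
    using mult_le_mono[of 1 "l 1" "l 0" "l 0 + 1"] by auto
  show ?case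
  proof (intro conjI allI impI)
    show "length (p # \<Phi>) \<le> ann_params (p # \<Phi>)" using IH * unfolding eq by simp
    fix i assume i: "i < length (p # \<Phi>)"
    show "l i \<le> ann_params (p # \<Phi>)" "l (Suc i) \<le> ann_params (p # \<Phi>)"
      using IH * i unfolding eq by (cases i; force)+
  qed
qed (simp add: ann_params_def)

text \<open>Entry point for arbitrary networks: the parameter count itself serves as width bound and
  as depth bound.\<close>

lemma ANN_net:
  assumes "\<Phi> \<in> ANN"
  obtains n k where "net (ann_params \<Phi>) n k \<Phi>" "length \<Phi> \<le> ann_params \<Phi>"
proof -
  obtain l where l: "\<Phi> \<noteq> []" "\<forall>k\<le>length \<Phi>. 1 \<le> l k"
    "\<forall>k<length \<Phi>. \<Phi> ! k \<in> carrier_mat (l (Suc k)) (l k) \<times> carrier_vec (l (Suc k))"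
    using assms unfolding ANN_iff by blast
  note * = ANN_dims_le_params[OF l(2,3)]
  \<comment> \<open>There is one more width than there are layers: \<open>l 0\<close> is bounded as
    the input width of the first layer, every other \<open>l i\<close> as the output width of layer
    \<open>i - 1\<close>.\<close>
  have "l i \<le> ann_params \<Phi>" if "i \<le> length \<Phi>" for i
    using * that l(1) by (cases i) (auto simp: Suc_le_eq)
  then have "\<forall>i\<le>length \<Phi>. l i \<in> {1..ann_params \<Phi>}" using l(2) by auto
  from net_of_dims[OF l(1) this l(3)] * that show thesis by blast
qed

section \<open>Evaluation and realization\<close>

lemma ann_eval_Cons:
  "\<Phi> \<noteq> [] \<Longrightarrow> ann_eval a ((W, B) # \<Phi>) x = ann_eval a \<Phi> (map_vec a (W *\<^sub>v x + B))"
  by (cases \<Phi>) auto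

lemma ann_eval_carrier:
  "net M n k \<Phi> \<Longrightarrow> x \<in> carrier_vec k \<Longrightarrow> ann_eval a \<Phi> x \<in> carrier_vec n"
proof (induction arbitrary: x rule: net.induct)
  case (net_cons W j k B \<Phi>)
  then show ?case using net_bounds[OF net_cons.hyps(4)] by (simp add: ann_eval_Cons)
qed simp

lemma realization_net:
  "net M n k \<Phi> \<Longrightarrow> realization a \<Phi> = (\<lambda>x. if x \<in> carrier_vec k then Some (ann_eval a \<Phi> x) else None)"
  by (auto simp: realization_def net_input_dim restrict_map_def)

section \<open>Constructions: padding, parallel networks, duplicated input\<close>

text \<open>No activation follows the last layer, so its affine map merges with the first affine map
  \<open>V1\<close>, \<open>b1\<close> of the identity network. Composing with the identity
  therefore costs exactly one layer, and the only new width is \<open>j\<close>.\<close>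

lemma net_extend:
  assumes "net M n k \<Phi>" and V: "V1 \<in> carrier_mat j n" "V2 \<in> carrier_mat n j"
    "b1 \<in> carrier_vec j" "b2 \<in> carrier_vec n" "j \<in> {1..M}"
    and id: "\<forall>x\<in>carrier_vec n. ann_eval a [(V1, b1), (V2, b2)] x = x"
  shows "\<exists>\<Phi>'. net M n k \<Phi>' \<and> length \<Phi>' = Suc (length \<Phi>) \<and>
    (\<forall>x\<in>carrier_vec k. ann_eval a \<Phi>' x = ann_eval a \<Phi> x)"
  using assms(1)
proof (induction rule: net.induct)
  case (net_single W k B)
  let ?\<Phi> = "[(V1 * W, V1 *\<^sub>v B + b1), (V2, b2)]"
  have "net M n k ?\<Phi>"
    using net_single V by (intro net.net_cons[of _ j] net.net_single) auto
  moreover have "ann_eval a ?\<Phi> x = ann_eval a [(W, B)] x" if "x \<in> carrier_vec k" for x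
  proof -
    have "(V1 * W) *\<^sub>v x + (V1 *\<^sub>v B + b1) = V1 *\<^sub>v (W *\<^sub>v x + B) + b1"
      using net_single V that
      by (subst mult_add_distrib_mat_vec[of _ j n]) (auto intro!: assoc_add_vec[symmetric])
    then show ?thesis
      using bspec[OF id, of "W *\<^sub>v x + B"] net_single that by simp
  qed
  ultimately show ?case by fastforce
next
  case (net_cons W l k B \<Phi>)
  then obtain \<Phi>' where \<Phi>': "net M n l \<Phi>'" "length \<Phi>' = Suc (length \<Phi>)"
    "\<forall>x\<in>carrier_vec l. ann_eval a \<Phi>' x = ann_eval a \<Phi> x" by blast
  have "\<Phi> \<noteq> []" "\<Phi>' \<noteq> []" using net_bounds net_cons.hyps(4) \<Phi>'(1) by blast+
  then show ?case using \<Phi>' net_cons.hyps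
    by (intro exI[of _ "(W, B) # \<Phi>'"]) (auto simp: ann_eval_Cons intro!: net.intros)
qed

lemma net_pad:
  assumes "net M n k \<Phi>" and V: "V1 \<in> carrier_mat j n" "V2 \<in> carrier_mat n j"
    "b1 \<in> carrier_vec j" "b2 \<in> carrier_vec n" "j \<in> {1..M}"
    and id: "\<forall>x\<in>carrier_vec n. ann_eval a [(V1, b1), (V2, b2)] x = x"
    and "length \<Phi> \<le> L"
  shows "\<exists>\<Phi>'. net M n k \<Phi>' \<and> length \<Phi>' = L \<and>
    (\<forall>x\<in>carrier_vec k. ann_eval a \<Phi>' x = ann_eval a \<Phi> x)"
  using \<open>length \<Phi> \<le> L\<close>
proof (induction L rule: dec_induct)
  case base
  then show ?case using assms(1) by blast
next
  case (step L)
  then obtain \<Phi>' where \<Phi>': "net M n k \<Phi>'" "length \<Phi>' = L"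
    "\<forall>x\<in>carrier_vec k. ann_eval a \<Phi>' x = ann_eval a \<Phi> x" by blast
  from net_extend[OF this(1) V id] \<Phi>' show ?case by auto
qed

lemma map_vec_append: "map_vec a (u @\<^sub>v v) = map_vec a u @\<^sub>v map_vec a v"
  by (rule eq_vecI) auto

text \<open>Block-diagonal hidden layers carry both computations side by side, and a componentwise
  activation respects concatenation. Equal depths make both last layers occur together; they are
  merged into one affine map that forms the linear combination.\<close>

lemma net_parallel:
  assumes "net M1 n k1 \<Phi>1" "net M2 n k2 \<Phi>2" "length \<Phi>1 = length \<Phi>2"
  shows "\<exists>\<Phi>. net (M1 + M2) n (k1 + k2) \<Phi> \<and> length \<Phi> = length \<Phi>1 \<and>
    (\<forall>x1\<in>carrier_vec k1. \<forall>x2\<in>carrier_vec k2.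
      ann_eval a \<Phi> (x1 @\<^sub>v x2) = c \<cdot>\<^sub>v ann_eval a \<Phi>1 x1 + ann_eval a \<Phi>2 x2)"
  using assms
proof (induction arbitrary: k2 \<Phi>2 rule: net.induct)
  case (net_single W1 k1 B1)
  obtain W2 B2 where \<Phi>2: "\<Phi>2 = [(W2, B2)]" "W2 \<in> carrier_mat n k2" "B2 \<in> carrier_vec n"
    "k2 \<in> {1..M2}"
    using net_single(5,6) by cases (use net_bounds in auto)
  \<comment> \<open>With lower blocks of zero rows this is W2 placed to the right of
    \<open>c\<close> times W1, in a form to which the product rule for block matrices applies. The
    lower part of the product is the empty vector.\<close>
  let ?W = "four_block_mat (c \<cdot>\<^sub>m W1) W2 (0\<^sub>m 0 k1) (0\<^sub>m 0 k2)"
  let ?B = "c \<cdot>\<^sub>v B1 + B2"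
  have W: "?W \<in> carrier_mat n (k1 + k2)"
    using four_block_carrier_mat[of "c \<cdot>\<^sub>m W1" n k1 "0\<^sub>m 0 k2" 0 k2] net_single by simp
  have "?W *\<^sub>v (x1 @\<^sub>v x2) + ?B = c \<cdot>\<^sub>v (W1 *\<^sub>v x1 + B1) + (W2 *\<^sub>v x2 + B2)"
    if x: "x1 \<in> carrier_vec k1" "x2 \<in> carrier_vec k2" for x1 x2
  proof -
    have "?W *\<^sub>v (x1 @\<^sub>v x2) = (c \<cdot>\<^sub>m W1 *\<^sub>v x1 + W2 *\<^sub>v x2)
        @\<^sub>v (0\<^sub>m 0 k1 *\<^sub>v x1 + 0\<^sub>m 0 k2 *\<^sub>v x2)"
      using net_single \<Phi>2 x by (intro four_block_mat_mult_vec) auto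
    also have "\<dots> = c \<cdot>\<^sub>m W1 *\<^sub>v x1 + W2 *\<^sub>v x2" by (rule eq_vecI) auto
    also have "c \<cdot>\<^sub>m W1 *\<^sub>v x1 = c \<cdot>\<^sub>v (W1 *\<^sub>v x1)"
      using net_single x by (intro eq_vecI) (auto simp: scalar_prod_def sum_distrib_left mult.assoc)
    finally show ?thesis using net_single \<Phi>2 x
      by (intro eq_vecI) (auto simp: algebra_simps)
  qed
  then show ?case
    using net_single \<Phi>2 W
    by (intro exI[of _ "[(?W, ?B)]"]) (auto intro!: net.net_single)
next
  case (net_cons W1 j1 k1 B1 \<Phi>1)
  note ne1 = net_bounds[OF net_cons.hyps(4)]
  obtain W2 B2 \<Phi>2' j2 where \<Phi>2: "\<Phi>2 = (W2, B2) # \<Phi>2'" "W2 \<in> carrier_mat j2 k2"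
    "B2 \<in> carrier_vec j2" "k2 \<in> {1..M2}" "net M2 n j2 \<Phi>2'"
    using net_cons.prems ne1 by cases auto
  note ne2 = net_bounds[OF \<Phi>2(5)]
  obtain \<Phi> where \<Phi>: "net (M1 + M2) n (j1 + j2) \<Phi>" "length \<Phi> = length \<Phi>1"
    "\<And>x1 x2. x1 \<in> carrier_vec j1 \<Longrightarrow> x2 \<in> carrier_vec j2 \<Longrightarrow>
      ann_eval a \<Phi> (x1 @\<^sub>v x2) = c \<cdot>\<^sub>v ann_eval a \<Phi>1 x1 + ann_eval a \<Phi>2' x2"
    using net_cons.IH[OF \<Phi>2(5)] net_cons.prems \<Phi>2(1) by auto
  have ne: "\<Phi> \<noteq> []" using net_bounds \<Phi>(1) by blast
  let ?W = "four_block_mat W1 (0\<^sub>m j1 k2) (0\<^sub>m j2 k1) W2"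
  let ?B = "B1 @\<^sub>v B2"
  have "?W *\<^sub>v (x1 @\<^sub>v x2) + ?B = (W1 *\<^sub>v x1 + B1) @\<^sub>v (W2 *\<^sub>v x2 + B2)"
    if x: "x1 \<in> carrier_vec k1" "x2 \<in> carrier_vec k2" for x1 x2
  proof -
    have "?W *\<^sub>v (x1 @\<^sub>v x2) = (W1 *\<^sub>v x1 + 0\<^sub>m j1 k2 *\<^sub>v x2) @\<^sub>v (0\<^sub>m j2 k1 *\<^sub>v x1 + W2 *\<^sub>v x2)"
      using net_cons \<Phi>2 x by (intro four_block_mat_mult_vec) auto
    also have "\<dots> = (W1 *\<^sub>v x1) @\<^sub>v (W2 *\<^sub>v x2)"
      using net_cons \<Phi>2 x by (intro arg_cong2[where f = append_vec] eq_vecI) auto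
    finally show ?thesis
      using append_vec_add[of "W1 *\<^sub>v x1" j1 B1 "W2 *\<^sub>v x2" j2 B2] net_cons \<Phi>2 x by simp
  qed
  then have "ann_eval a ((?W, ?B) # \<Phi>) (x1 @\<^sub>v x2)
      = c \<cdot>\<^sub>v ann_eval a ((W1, B1) # \<Phi>1) x1 + ann_eval a \<Phi>2 x2"
    if "x1 \<in> carrier_vec k1" "x2 \<in> carrier_vec k2" for x1 x2
    using that net_cons \<Phi>2 ne ne1 ne2 by (simp add: ann_eval_Cons map_vec_append \<Phi>(3))
  moreover have "net (M1 + M2) n (k1 + k2) ((?W, ?B) # \<Phi>)"
    using \<Phi>(1) net_cons.hyps \<Phi>2 by (auto intro!: net.intros)
  ultimately show ?case using \<Phi>(2) by (intro exI[of _ "(?W, ?B) # \<Phi>"]) auto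
qed

text \<open>Duplication is linear: two stacked identity matrices map \<open>x\<close> to
  \<open>x @\<^sub>v x\<close>. Multiplying this matrix into the first weight matrix changes neither
  the depth nor the width bound.\<close>

lemma net_duplicate_input:
  assumes "net M n (k + k) \<Phi>"
  shows "\<exists>\<Phi>'. net M n k \<Phi>' \<and> length \<Phi>' = length \<Phi> \<and>
    (\<forall>x\<in>carrier_vec k. ann_eval a \<Phi>' x = ann_eval a \<Phi> (x @\<^sub>v x))"
proof -
  let ?D = "1\<^sub>m k @\<^sub>r 1\<^sub>m k :: real mat"
  have D: "?D \<in> carrier_mat (k + k) k" by simp
  have Dx: "(W * ?D) *\<^sub>v x = W *\<^sub>v (x @\<^sub>v x)"
    if "W \<in> carrier_mat j (k + k)" "x \<in> carrier_vec k" for W j x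
    using that assoc_mult_mat_vec[OF that(1) D that(2)]
      mat_mult_append[of "1\<^sub>m k" k k "1\<^sub>m k" k x] by simp
  from assms show ?thesis
  proof cases
    case (net_single W B)
    then show ?thesis using D Dx[of W n]
      by (intro exI[of _ "[(W * ?D, B)]"]) (auto intro!: net.net_single mult_carrier_mat)
  next
    case (net_cons W j B \<Phi>')
    then show ?thesis using D Dx[of W j] net_bounds[OF net_cons(5)]
      by (intro exI[of _ "(W * ?D, B) # \<Phi>'"])
        (auto simp: ann_eval_Cons intro!: net.intros mult_carrier_mat)
  qed
qed

section \<open>Norm estimates\<close>

lemma vnorm_add_le:
  assumes "u \<in> carrier_vec n" "v \<in> carrier_vec n"
  shows "vnorm (u + v) \<le> vnorm u + vnorm v"
proof -
  have "vnorm (u + v) = L2_set (\<lambda>i. u $ i + v $ i) {..<n}"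
    using assms unfolding vnorm_def by (intro L2_set_cong) auto
  with assms L2_set_triangle_ineq[of "\<lambda>i. u $ i" "\<lambda>i. v $ i" "{..<n}"]
  show ?thesis by (simp add: vnorm_def)
qed

lemma vnorm_smult: "vnorm (c \<cdot>\<^sub>v v) = \<bar>c\<bar> * vnorm v"
proof -
  have "vnorm (c \<cdot>\<^sub>v v) = L2_set (\<lambda>i. c * v $ i) {..<dim_vec v}"
    unfolding vnorm_def by (intro L2_set_cong) auto
  then show ?thesis
    by (simp add: vnorm_def L2_set_def power_mult_distrib real_sqrt_mult flip: sum_distrib_left)
qed

lemma vnorm_nonneg: "0 \<le> vnorm v"
  by (simp add: vnorm_def)

text \<open>Used twice: for continuity of a linear combination and for its approximation
  error.\<close>

lemma vnorm_lincomb_diff_le: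
  assumes "u \<in> carrier_vec n" "u' \<in> carrier_vec n" "v \<in> carrier_vec n" "v' \<in> carrier_vec n"
  shows "vnorm ((c \<cdot>\<^sub>v u + v) - (c \<cdot>\<^sub>v u' + v')) \<le> \<bar>c\<bar> * vnorm (u - u') + vnorm (v - v')"
proof -
  have "(c \<cdot>\<^sub>v u + v) - (c \<cdot>\<^sub>v u' + v') = c \<cdot>\<^sub>v (u - u') + (v - v')"
    using assms by (intro eq_vecI) (auto simp: algebra_simps)
  then show ?thesis
    using vnorm_add_le[of "c \<cdot>\<^sub>v (u - u')" n "v - v'"] assms by (simp add: vnorm_smult)
qed

section \<open>Continuous functions as partial maps\<close>

lemma cont_funs_app:
  assumes "f \<in> cont_funs m n" "x \<in> carrier_vec m"
  shows "f x = Some (the (f x))" "the (f x) \<in> carrier_vec n"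
proof -
  have "x \<in> dom f" using assms by (simp add: cont_funs_def)
  then obtain y where "f x = Some y" by blast
  then show "f x = Some (the (f x))" "the (f x) \<in> carrier_vec n"
    using assms by (auto simp: cont_funs_def intro: ranI)
qed

lemma cont_funs_outside: "f \<in> cont_funs m n \<Longrightarrow> x \<notin> carrier_vec m \<Longrightarrow> f x = None"
  by (auto simp: cont_funs_def)

text \<open>The domain determines \<open>m\<close>, and the dimension of the value at the zero
  vector determines \<open>n\<close>. This identifies the existentially quantified dimensions in
  \<open>approx_space\<close> with the prescribed ones.\<close>

lemma cont_funs_unique:
  assumes "f \<in> cont_funs m n" "f \<in> cont_funs m' n'"
  shows "m = m' \<and> n = n'"
proof -
  have 0: "(0\<^sub>v m :: real vec) \<in> carrier_vec m" by simp
  moreover have "carrier_vec m = (carrier_vec m' :: real vec set)"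
    using assms by (auto simp: cont_funs_def)
  ultimately have 1: "(0\<^sub>v m :: real vec) \<in> carrier_vec m'" by simp
  from carrier_vecD[OF cont_funs_app(2)[OF assms(1) 0]]
    carrier_vecD[OF cont_funs_app(2)[OF assms(2) 1]] carrier_vecD[OF 1] show ?thesis
    by simp
qed

lemma lincomb_app:
  assumes "f \<in> cont_funs m n" "g \<in> cont_funs m n"
  shows "vfun_add (vfun_scale c f) g =
    (\<lambda>x. if x \<in> carrier_vec m then Some (c \<cdot>\<^sub>v the (f x) + the (g x)) else None)"
proof
  fix x
  show "vfun_add (vfun_scale c f) g x =
      (if x \<in> carrier_vec m then Some (c \<cdot>\<^sub>v the (f x) + the (g x)) else None)"
  proof (cases "x \<in> carrier_vec m")
    case True
    obtain u v where "f x = Some u" "g x = Some v"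
      using cont_funs_app(1)[OF assms(1) True] cont_funs_app(1)[OF assms(2) True] by blast
    with True show ?thesis by (simp add: vfun_add_def vfun_scale_def)
  next
    case False
    with cont_funs_outside[OF assms(1) False] show ?thesis
      by (simp add: vfun_add_def vfun_scale_def)
  qed
qed

lemma cont_funs_lincomb:
  assumes "f \<in> cont_funs m n" "g \<in> cont_funs m n"
  shows "vfun_add (vfun_scale c f) g \<in> cont_funs m n" (is "?h \<in> _")
proof -
  note h = lincomb_app[OF assms, of c]
  have "\<exists>\<delta>>0. \<forall>y\<in>carrier_vec m. vnorm (y - x) < \<delta> \<longrightarrow> vnorm (the (?h y) - the (?h x)) < e"
    if x: "x \<in> carrier_vec m" and e: "e > 0" for x e
  proof -
    \<comment> \<open>Chosen so that \<open>\<bar>c\<bar> * ?e + ?e = e\<close>; the summand 1 keeps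
      the denominator positive when \<open>c = 0\<close>.\<close>
    let ?e = "e / (\<bar>c\<bar> + 1)"
    have e': "?e > 0" using e by (simp add: add_nonneg_pos)
    obtain \<delta>1 where \<delta>1: "\<delta>1 > 0"
      "\<And>y. y \<in> carrier_vec m \<Longrightarrow> vnorm (y - x) < \<delta>1 \<Longrightarrow> vnorm (the (f y) - the (f x)) < ?e"
      using assms(1) x e' unfolding cont_funs_def by blast
    obtain \<delta>2 where \<delta>2: "\<delta>2 > 0"
      "\<And>y. y \<in> carrier_vec m \<Longrightarrow> vnorm (y - x) < \<delta>2 \<Longrightarrow> vnorm (the (g y) - the (g x)) < ?e"
      using assms(2) x e' unfolding cont_funs_def by blast
    have "vnorm (the (?h y) - the (?h x)) < e"
      if y: "y \<in> carrier_vec m" "vnorm (y - x) < min \<delta>1 \<delta>2" for y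
    proof -
      have "vnorm (the (?h y) - the (?h x)) \<le>
          \<bar>c\<bar> * vnorm (the (f y) - the (f x)) + vnorm (the (g y) - the (g x))"
        using vnorm_lincomb_diff_le[OF cont_funs_app(2)[OF assms(1) y(1)]
            cont_funs_app(2)[OF assms(1) x] cont_funs_app(2)[OF assms(2) y(1)]
            cont_funs_app(2)[OF assms(2) x]] x y(1) by (simp add: h)
      also have "\<dots> < \<bar>c\<bar> * ?e + ?e"
        using \<delta>1(2)[OF y(1)] \<delta>2(2)[OF y(1)] y(2)
        by (intro add_le_less_mono mult_left_mono) auto
      also have "\<dots> = (\<bar>c\<bar> + 1) * ?e" by (simp only: distrib_right mult_1)
      also have "\<dots> = e" by (simp add: add_nonneg_eq_0_iff)
      finally show ?thesis .
    qed
    then show ?thesis using \<delta>1(1) \<delta>2(1) by (intro exI[of _ "min \<delta>1 \<delta>2"]) auto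
  qed
  moreover have "dom ?h = carrier_vec m" by (auto simp: h split: if_splits)
  moreover have "ran ?h \<subseteq> carrier_vec n"
    using cont_funs_app(2)[OF assms(1)] cont_funs_app(2)[OF assms(2)]
    by (auto simp: h ran_def split: if_splits)
  ultimately show ?thesis by (auto simp: cont_funs_def)
qed

section \<open>Linear combination of two networks\<close>

text \<open>The dimension list forces exactly two layers. It records neither the column number of
  the second matrix nor the bias lengths; these come from membership in \<open>ANN\<close>.\<close>

lemma identity_layers:
  assumes "\<Psi> \<in> ANN" "realization a \<Psi> = vfun_id n" "ann_dims \<Psi> = [n, j, n]"
  obtains V1 V2 b1 b2 where "V1 \<in> carrier_mat j n" "V2 \<in> carrier_mat n j"
    "b1 \<in> carrier_vec j" "b2 \<in> carrier_vec n" "1 \<le> j"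
    "\<forall>x\<in>carrier_vec n. ann_eval a [(V1, b1), (V2, b2)] x = x"
proof -
  obtain V1 b1 V2 b2 where \<Psi>: "\<Psi> = [(V1, b1), (V2, b2)]"
    using assms(3) by (auto simp: ann_dims_def map_eq_Cons_conv)
  obtain l where l: "\<forall>k\<le>2. 1 \<le> l k"
    "\<forall>k<2. \<Psi> ! k \<in> carrier_mat (l (Suc k)) (l k) \<times> carrier_vec (l (Suc k))"
    using assms(1) unfolding ANN_iff \<Psi> by (auto simp: numeral_2_eq_2)
  have d: "V1 \<in> carrier_mat (l 1) (l 0)" "b1 \<in> carrier_vec (l 1)"
    "V2 \<in> carrier_mat (l 2) (l 1)" "b2 \<in> carrier_vec (l 2)" "1 \<le> l 1"
    using l(2)[rule_format, of 0] l(2)[rule_format, of 1] l(1) by (auto simp: \<Psi> numeral_2_eq_2)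
  have e: "l 0 = n" "l 1 = j" "l 2 = n" using assms(3) d by (auto simp: ann_dims_def \<Psi>)
  have "ann_eval a [(V1, b1), (V2, b2)] x = x" if "x \<in> carrier_vec n" for x
    using fun_cong[OF assms(2), of x] that assms(3)
    by (simp add: realization_def vfun_id_def \<Psi>)
  with d e that show thesis by metis
qed

text \<open>The left side is the bound of \<open>net_params\<close> for depth \<open>max P Q\<close>
  and width \<open>C * P + C * Q\<close>, the size of the combined network in
  \<open>ANN_lincomb\<close>.\<close>

lemma cubic_param_bound:
  fixes C P Q :: nat
  assumes "1 \<le> C" "1 \<le> P" "1 \<le> Q"
  shows "max P Q * ((C * P + C * Q) * ((C * P + C * Q) + 1)) \<le> 16 * C^2 * (P * Q)^3"
proof -
  let ?S = "P + Q"
  have "P * 1 \<le> P * Q" "1 * Q \<le> P * Q" using assms by (intro mult_le_mono; simp)+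
  then have S: "?S \<le> 2 * (P * Q)" by linarith
  \<comment> \<open>Lets the bias summand 1 be absorbed into a second copy of
    \<open>C * ?S\<close>.\<close>
  have "1 * 1 \<le> C * ?S" using assms by (intro mult_le_mono) auto
  then have "max P Q * (C * ?S * (C * ?S + 1)) \<le> ?S * (C * ?S * (C * ?S + C * ?S))"
    by (intro mult_le_mono add_le_mono) auto
  also have "\<dots> = 2 * C^2 * ?S^3" by (simp add: power2_eq_square power3_eq_cube algebra_simps)
  also have "\<dots> \<le> 2 * C^2 * (2 * (P * Q))^3" using S by (intro mult_le_mono power_mono) auto
  also have "\<dots> = 16 * C^2 * (P * Q)^3" by (simp add: power_mult_distrib)
  finally show ?thesis by (simp add: distrib_left)
qed

text \<open>Assembles padding, parallel networks and duplicated input. The size bound involves only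
  \<open>C\<close> and the two parameter counts, not the dimensions \<open>m\<close>,
  \<open>n\<close>, \<open>j\<close>.\<close>

lemma ANN_lincomb:
  assumes "\<Phi> \<in> ANN" "\<Phi>' \<in> ANN"
    and R: "realization a \<Phi> \<in> cont_funs m n" "realization a \<Phi>' \<in> cont_funs m n"
    and \<Psi>: "\<Psi> \<in> ANN" "realization a \<Psi> = vfun_id n" "ann_dims \<Psi> = [n, j, n]"
    and C: "j \<le> C * n" "1 \<le> C"
  shows "\<exists>\<Gamma>\<in>ANN. realization a \<Gamma> = vfun_add (vfun_scale c (realization a \<Phi>)) (realization a \<Phi>') \<and>
    ann_params \<Gamma> \<le> 16 * C^2 * (ann_params \<Phi> * ann_params \<Phi>')^3"
proof -
  obtain V1 V2 b1 b2 where V: "V1 \<in> carrier_mat j n" "V2 \<in> carrier_mat n j"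
    "b1 \<in> carrier_vec j" "b2 \<in> carrier_vec n" "1 \<le> j"
    "\<forall>x\<in>carrier_vec n. ann_eval a [(V1, b1), (V2, b2)] x = x"
    by (rule identity_layers[OF \<Psi>]) blast
  \<comment> \<open>Both networks are padded to this common depth; each parameter count bounds the
    depth of its own network.\<close>
  let ?L = "max (ann_params \<Phi>) (ann_params \<Phi>')"
  have pad: "\<exists>\<Gamma>. net (C * ann_params \<Theta>) n m \<Gamma> \<and> length \<Gamma> = ?L \<and> 1 \<le> ann_params \<Theta> \<and>
      (\<forall>x\<in>carrier_vec m. Some (ann_eval a \<Gamma> x) = realization a \<Theta> x)"
    if \<Theta>: "\<Theta> \<in> ANN" "realization a \<Theta> \<in> cont_funs m n" "ann_params \<Theta> \<le> ?L" for \<Theta>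
  proof -
    obtain n' m' where net: "net (ann_params \<Theta>) n' m' \<Theta>" and len: "length \<Theta> \<le> ann_params \<Theta>"
      using ANN_net[OF \<Theta>(1)] by blast
    note r = realization_net[OF net, of a]
    \<comment> \<open>The dimensions from \<open>ANN_net\<close> are matched with \<open>m\<close>
      and \<open>n\<close> by comparing domains and then values at the zero vector.\<close>
    have "carrier_vec m = dom (realization a \<Theta>)" using \<Theta>(2) by (simp add: cont_funs_def)
    also have "\<dots> = carrier_vec m'" by (auto simp: r split: if_splits)
    finally have m: "(0\<^sub>v m :: real vec) \<in> carrier_vec m'" using zero_carrier_vec by metis
    then have m': "m' = m" using carrier_vecD[OF m] by simp
    have "n' = n"
      using carrier_vecD[OF cont_funs_app(2)[OF \<Theta>(2) zero_carrier_vec]]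
        carrier_vecD[OF ann_eval_carrier[OF net m, of a]] m
      by (simp add: r)
    note net = net[unfolded this m'] and r = r[unfolded m']
    have M: "ann_params \<Theta> \<le> C * ann_params \<Theta>" using C(2) by (cases C) auto
    \<comment> \<open>The output width \<open>n\<close> is at most the parameter count, so the
      hidden layer of the identity network, of width \<open>j \<le> C * n\<close>, respects the
      enlarged width bound.\<close>
    have "C * n \<le> C * ann_params \<Theta>" using net_bounds[OF net] by (intro mult_le_mono) auto
    from order_trans[OF C(1) this] V(5) have "j \<in> {1..C * ann_params \<Theta>}" by simp
    from net_pad[OF net_mono[OF net M] V(1-4) this V(6), of ?L] order_trans[OF len \<Theta>(3)]
    obtain \<Gamma> where "net (C * ann_params \<Theta>) n m \<Gamma>" "length \<Gamma> = ?L"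
      "\<forall>x\<in>carrier_vec m. ann_eval a \<Gamma> x = ann_eval a \<Theta> x" by blast
    moreover have "1 \<le> ann_params \<Theta>" using net_bounds[OF net] by simp
    ultimately show ?thesis unfolding r by (intro exI[of _ \<Gamma>]) simp
  qed
  obtain \<Gamma>1 where 1: "net (C * ann_params \<Phi>) n m \<Gamma>1" "length \<Gamma>1 = ?L" "1 \<le> ann_params \<Phi>"
      "\<And>x. x \<in> carrier_vec m \<Longrightarrow> realization a \<Phi> x = Some (ann_eval a \<Gamma>1 x)"
    using pad[OF assms(1) R(1) max.cobounded1] by metis
  obtain \<Gamma>2 where 2: "net (C * ann_params \<Phi>') n m \<Gamma>2" "length \<Gamma>2 = ?L" "1 \<le> ann_params \<Phi>'"
      "\<And>x. x \<in> carrier_vec m \<Longrightarrow> realization a \<Phi>' x = Some (ann_eval a \<Gamma>2 x)"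
    using pad[OF assms(2) R(2) max.cobounded2] by metis
  let ?M = "C * ann_params \<Phi> + C * ann_params \<Phi>'"
  obtain \<Gamma>3 where 3: "net ?M n (m + m) \<Gamma>3" "length \<Gamma>3 = ?L"
    "\<And>x1 x2. x1 \<in> carrier_vec m \<Longrightarrow> x2 \<in> carrier_vec m \<Longrightarrow>
      ann_eval a \<Gamma>3 (x1 @\<^sub>v x2) = c \<cdot>\<^sub>v ann_eval a \<Gamma>1 x1 + ann_eval a \<Gamma>2 x2"
    using net_parallel[OF 1(1) 2(1), of a c] unfolding 1(2) 2(2) by blast
  obtain \<Gamma> where \<Gamma>: "net ?M n m \<Gamma>" "length \<Gamma> = ?L"
    "\<And>x. x \<in> carrier_vec m \<Longrightarrow> ann_eval a \<Gamma> x = ann_eval a \<Gamma>3 (x @\<^sub>v x)"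
    using net_duplicate_input[OF 3(1), of a] unfolding 3(2) by blast
  have "ann_params \<Gamma> \<le> ?L * (?M * (?M + 1))" using net_params[OF \<Gamma>(1)] \<Gamma>(2) by simp
  also have "\<dots> \<le> 16 * C^2 * (ann_params \<Phi> * ann_params \<Phi>')^3"
    by (rule cubic_param_bound[OF C(2) 1(3) 2(3)])
  finally have "ann_params \<Gamma> \<le> 16 * C^2 * (ann_params \<Phi> * ann_params \<Phi>')^3" .
  moreover have "realization a \<Gamma> = vfun_add (vfun_scale c (realization a \<Phi>)) (realization a \<Phi>')"
    unfolding lincomb_app[OF R] realization_net[OF \<Gamma>(1)] by (simp add: 1(4) 2(4) 3(3) \<Gamma>(3) cong: if_cong)
  ultimately show ?thesis using net_ANN[OF \<Gamma>(1)] by blast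
qed

theorem lemma3p15:
  fixes N :: nat and I :: "'i set" and \<dd> :: "'i \<Rightarrow> nat \<Rightarrow> nat"
    and lam c :: real and a w :: "real \<Rightarrow> real"
    and \<ii> :: "nat \<Rightarrow> nat" and \<Psi> :: "nat \<Rightarrow> ann"
    and \<II> \<OO> :: "'i \<Rightarrow> nat" and f g :: "'i \<Rightarrow> vfun"
  assumes "N \<ge> 1" and "I \<noteq> {}"
    and "\<dd> \<in> I \<rightarrow> {1..N} \<rightarrow> {1..}"
    and "continuous_on UNIV a"
    and "\<ii> \<in> {1..} \<rightarrow> {1..}" and "\<Psi> \<in> {1..} \<rightarrow> ANN"
    and "\<forall>d\<ge>1. realization a (\<Psi> d) = vfun_id d"
    and "\<forall>d\<ge>1. ann_dims (\<Psi> d) = [d, \<ii> d, d]"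
    and "\<forall>d\<ge>1. real (\<ii> d) \<le> c * real d"
    and "w \<in> {0..} \<rightarrow> {0..}"
    and "\<II> \<in> I \<rightarrow> {1..}" and "\<OO> \<in> I \<rightarrow> {1..}"
    and "f \<in> approx_union a w N I \<dd>" and "g \<in> approx_union a w N I \<dd>"
    and "\<forall>i\<in>I. {f i, g i} \<subseteq> cont_funs (\<II> i) (\<OO> i)"
  shows "(\<lambda>i. vfun_add (vfun_scale lam (f i)) (g i)) \<in> approx_union a w N I \<dd>"
proof -
  \<comment> \<open>Rounds \<open>c\<close> up to a natural number that is at least 1, as
    \<open>ANN_lincomb\<close> requires.\<close>
  define C :: nat where "C = nat \<lceil>max 1 c\<rceil>"
  have C: "1 \<le> C" "c \<le> real C" unfolding C_def by linarith+
  have \<ii>: "\<ii> d \<le> C * d" if "1 \<le> d" for d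
  proof -
    have "real (\<ii> d) \<le> real C * real d"
      using order_trans[OF assms(9)[rule_format, OF that] mult_right_mono[OF C(2)]] by simp
    then show ?thesis by (simp flip: of_nat_mult)
  qed
  \<comment> \<open>The growth rate without its constant. By \<open>U_add\<close>, multiplying rates
    adds exponents, whatever their signs.\<close>
  define U where "U r i \<epsilon> = \<epsilon> powr (- r 0) * (\<Prod>l=1..N. \<bar>real (\<dd> i l)\<bar> powr r l)"
    for r :: "nat \<Rightarrow> real" and i \<epsilon>
  have U_add: "U (\<lambda>l. r l + s l) i \<epsilon> = U r i \<epsilon> * U s i \<epsilon>" for r s i \<epsilon>
    using powr_add[of \<epsilon> "- r 0" "- s 0"] by (simp add: U_def powr_add prod.distrib)
  define approximable where "approximable h K r \<longleftrightarrow> (\<forall>i\<in>I. \<forall>\<epsilon>\<in>{0<..1}. \<exists>\<Phi>\<in>ANN. \<exists>m\<ge>1. \<exists>n\<ge>1.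
       {h i, realization a \<Phi>} \<subseteq> cont_funs m n \<and>
       real (ann_params \<Phi>) \<le> K * \<epsilon> powr (- r 0) * (\<Prod>l=1..N. \<bar>real (\<dd> i l)\<bar> powr r l) \<and>
       (SUP x\<in>carrier_vec m. ereal (w (vnorm x) * vnorm (the (h i x) - the (realization a \<Phi> x))))
         \<le> ereal \<epsilon>)"
    for h :: "'i \<Rightarrow> vfun" and K :: real and r :: "nat \<Rightarrow> real"
  \<comment> \<open>Normal form of the hypothesis: dimensions fixed by
    \<open>cont_funs_unique\<close>, and the supremum replaced by a pointwise bound.\<close>
  have approx: "\<exists>\<Phi>\<in>ANN. realization a \<Phi> \<in> cont_funs (\<II> i) (\<OO> i) \<and>
      real (ann_params \<Phi>) \<le> K * U r i \<epsilon> \<and>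
      (\<forall>x\<in>carrier_vec (\<II> i). w (vnorm x) * vnorm (the (h i x) - the (realization a \<Phi> x)) \<le> \<epsilon>)"
    if K: "approximable h K r"
      and h: "h i \<in> cont_funs (\<II> i) (\<OO> i)" and i: "i \<in> I" and \<epsilon>: "\<epsilon> \<in> {0<..1}"
    for h K r i \<epsilon>
  proof -
    obtain \<Phi> m n where \<Phi>: "\<Phi> \<in> ANN" "h i \<in> cont_funs m n" "realization a \<Phi> \<in> cont_funs m n"
      "real (ann_params \<Phi>) \<le> K * \<epsilon> powr (- r 0) * (\<Prod>l=1..N. \<bar>real (\<dd> i l)\<bar> powr r l)"
      "(SUP x\<in>carrier_vec m. ereal (w (vnorm x) * vnorm (the (h i x) - the (realization a \<Phi> x))))
         \<le> ereal \<epsilon>"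
      using K[unfolded approximable_def, rule_format, OF i \<epsilon>] by blast
    have "m = \<II> i" "n = \<OO> i" using cont_funs_unique[OF \<Phi>(2) h] by auto
    with \<Phi> show ?thesis unfolding SUP_le_iff by (auto simp: U_def mult.assoc)
  qed
  obtain r K where "approximable f K r"
    using assms(13) unfolding approx_union_def approx_space_def approximable_def by blast
  note f = approx[OF this]
  obtain s J where "approximable g J s"
    using assms(14) unfolding approx_union_def approx_space_def approximable_def by blast
  note g = approx[OF this]
  let ?h = "\<lambda>i. vfun_add (vfun_scale lam (f i)) (g i)"
  have fg: "f i \<in> cont_funs (\<II> i) (\<OO> i)" "g i \<in> cont_funs (\<II> i) (\<OO> i)" if "i \<in> I" for i
    using assms(15) that by auto
  have h: "?h i \<in> cont_funs (\<II> i) (\<OO> i)" if "i \<in> I" for i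
    using cont_funs_lincomb[OF fg[OF that]] .
  have dims: "1 \<le> \<II> i" "1 \<le> \<OO> i" if "i \<in> I" for i using assms(11,12) that by auto
  \<comment> \<open>Both families are approximated to accuracy \<open>\<epsilon> * q\<close>, so the
    total error is at most
    \<open>(\<bar>lam\<bar> + 1) * (\<epsilon> * q) = \<epsilon>\<close>.\<close>
  define q where "q = 1 / (\<bar>lam\<bar> + 1)"
  have q: "0 < q" "q \<le> 1" "(\<bar>lam\<bar> + 1) * q = 1" unfolding q_def by (auto simp: divide_simps)
  \<comment> \<open>Three times \<open>r + s\<close>, matching the cube in the parameter bound;
    written as nested sums so that \<open>U_add\<close> rewrites it.\<close>
  define t where "t l = (r l + s l) + ((r l + s l) + (r l + s l))" for l
  have U_t: "U t i \<epsilon> = (U r i \<epsilon> * U s i \<epsilon>)^3" for i \<epsilon>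
    unfolding t_def U_add by (simp add: power3_eq_cube)
  \<comment> \<open>Collects the constant of \<open>ANN_lincomb\<close>, the cubed constants of both
    families, and the factor caused by passing from \<open>\<epsilon>\<close> to
    \<open>\<epsilon> * q\<close>.\<close>
  define A where "A = 16 * real C^2 * (K * J)^3 * q powr (- t 0)"
  have main: "\<exists>\<Gamma>\<in>ANN. realization a \<Gamma> \<in> cont_funs (\<II> i) (\<OO> i) \<and>
      real (ann_params \<Gamma>) \<le> A * U t i \<epsilon> \<and>
      (\<forall>x\<in>carrier_vec (\<II> i). w (vnorm x) * vnorm (the (?h i x) - the (realization a \<Gamma> x)) \<le> \<epsilon>)"
    if i: "i \<in> I" and \<epsilon>: "\<epsilon> \<in> {0<..1}" for i \<epsilon>
  proof -
    have \<epsilon>q: "\<epsilon> * q \<in> {0<..1}" using \<epsilon> q by (auto intro: mult_le_one)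
    note fgi = fg[OF i]
    obtain \<Phi> where \<Phi>: "\<Phi> \<in> ANN" "realization a \<Phi> \<in> cont_funs (\<II> i) (\<OO> i)"
      "real (ann_params \<Phi>) \<le> K * U r i (\<epsilon> * q)"
      "\<forall>x\<in>carrier_vec (\<II> i). w (vnorm x) * vnorm (the (f i x) - the (realization a \<Phi> x)) \<le> \<epsilon> * q"
      using f[OF fgi(1) i \<epsilon>q] by blast
    obtain \<Phi>' where \<Phi>': "\<Phi>' \<in> ANN" "realization a \<Phi>' \<in> cont_funs (\<II> i) (\<OO> i)"
      "real (ann_params \<Phi>') \<le> J * U s i (\<epsilon> * q)"
      "\<forall>x\<in>carrier_vec (\<II> i). w (vnorm x) * vnorm (the (g i x) - the (realization a \<Phi>' x)) \<le> \<epsilon> * q"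
      using g[OF fgi(2) i \<epsilon>q] by blast
    have \<Psi>: "\<Psi> (\<OO> i) \<in> ANN" "realization a (\<Psi> (\<OO> i)) = vfun_id (\<OO> i)"
      "ann_dims (\<Psi> (\<OO> i)) = [\<OO> i, \<ii> (\<OO> i), \<OO> i]"
      using assms(6-8) dims[OF i] by auto
    obtain \<Gamma> where \<Gamma>: "\<Gamma> \<in> ANN"
      "realization a \<Gamma> = vfun_add (vfun_scale lam (realization a \<Phi>)) (realization a \<Phi>')"
      "ann_params \<Gamma> \<le> 16 * C^2 * (ann_params \<Phi> * ann_params \<Phi>')^3"
      using ANN_lincomb[OF \<Phi>(1) \<Phi>'(1) \<Phi>(2) \<Phi>'(2) \<Psi> \<ii>[OF dims(2)[OF i]] C(1)] by blast
    have "real (ann_params \<Gamma>) \<le> real (16 * C^2 * (ann_params \<Phi> * ann_params \<Phi>')^3)"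
      using \<Gamma>(3) by (simp only: of_nat_le_iff)
    also have "\<dots> = 16 * real C^2 * (real (ann_params \<Phi>) * real (ann_params \<Phi>'))^3" by simp
    \<comment> \<open>No sign of \<open>K\<close> is assumed; nonnegativity of
      \<open>K * U r i (\<epsilon> * q)\<close> follows because it bounds a parameter count.\<close>
    also have "\<dots> \<le> 16 * real C^2 * ((K * U r i (\<epsilon> * q)) * (J * U s i (\<epsilon> * q)))^3"
      using \<Phi>(3) \<Phi>'(3) order_trans[OF of_nat_0_le_iff \<Phi>(3)]
      by (intro mult_left_mono power_mono mult_mono) auto
    also have "\<dots> = 16 * real C^2 * (K * J)^3 * U t i (\<epsilon> * q)"
      by (simp add: U_t power_mult_distrib)
    \<comment> \<open>Only the accuracy factor of \<open>U\<close> changes; the product over the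
      dimension mapping stays the same.\<close>
    also have "U t i (\<epsilon> * q) = q powr (- t 0) * U t i \<epsilon>"
      using \<epsilon> q by (simp add: U_def powr_mult)
    finally have "real (ann_params \<Gamma>) \<le> A * U t i \<epsilon>" by (simp add: A_def mult.assoc)
    moreover have "realization a \<Gamma> \<in> cont_funs (\<II> i) (\<OO> i)"
      unfolding \<Gamma>(2) by (rule cont_funs_lincomb[OF \<Phi>(2) \<Phi>'(2)])
    moreover have "w (vnorm x) * vnorm (the (?h i x) - the (realization a \<Gamma> x)) \<le> \<epsilon>"
      if x: "x \<in> carrier_vec (\<II> i)" for x
    proof -
      have w: "0 \<le> w (vnorm x)" using assms(10) vnorm_nonneg[of x] by auto
      have "w (vnorm x) * vnorm (the (?h i x) - the (realization a \<Gamma> x))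
          \<le> w (vnorm x) * (\<bar>lam\<bar> * vnorm (the (f i x) - the (realization a \<Phi> x))
            + vnorm (the (g i x) - the (realization a \<Phi>' x)))"
        using w x cont_funs_app(2)[OF fgi(1) x] cont_funs_app(2)[OF fgi(2) x]
          cont_funs_app(2)[OF \<Phi>(2) x] cont_funs_app(2)[OF \<Phi>'(2) x]
        unfolding \<Gamma>(2) lincomb_app[OF fgi] lincomb_app[OF \<Phi>(2) \<Phi>'(2)]
        by (auto intro!: mult_left_mono vnorm_lincomb_diff_le)
      also have "\<dots> = \<bar>lam\<bar> * (w (vnorm x) * vnorm (the (f i x) - the (realization a \<Phi> x)))
            + w (vnorm x) * vnorm (the (g i x) - the (realization a \<Phi>' x))"
        by (simp add: algebra_simps)
      also have "\<dots> \<le> \<bar>lam\<bar> * (\<epsilon> * q) + \<epsilon> * q"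
        using \<Phi>(4) \<Phi>'(4) x by (intro add_mono mult_left_mono) auto
      also have "\<dots> = \<epsilon> * ((\<bar>lam\<bar> + 1) * q)" by (simp add: algebra_simps)
      finally show ?thesis by (simp add: q(3))
    qed
    ultimately show ?thesis using \<Gamma>(1) by blast
  qed
  have "?h \<in> approx_space a w N t I \<dd>"
    unfolding approx_space_def
  proof (intro CollectI conjI exI[of _ A] ballI)
    show "?h \<in> function_families I"
      using h dims by (fastforce simp: function_families_def)
    fix i \<epsilon> assume i: "i \<in> I" and \<epsilon>: "\<epsilon> \<in> {0<..1::real}"
    from main[OF this] obtain \<Gamma> where \<Gamma>: "\<Gamma> \<in> ANN" "realization a \<Gamma> \<in> cont_funs (\<II> i) (\<OO> i)"
      "real (ann_params \<Gamma>) \<le> A * U t i \<epsilon>"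
      "\<forall>x\<in>carrier_vec (\<II> i). w (vnorm x) * vnorm (the (?h i x) - the (realization a \<Gamma> x)) \<le> \<epsilon>"
      by blast
    show "\<exists>\<Phi>\<in>ANN. \<exists>m\<ge>1. \<exists>n\<ge>1. {?h i, realization a \<Phi>} \<subseteq> cont_funs m n \<and>
       real (ann_params \<Phi>) \<le> A * \<epsilon> powr (- t 0) * (\<Prod>l=1..N. \<bar>real (\<dd> i l)\<bar> powr t l) \<and>
       (SUP x\<in>carrier_vec m. ereal (w (vnorm x) * vnorm (the (?h i x) - the (realization a \<Phi> x))))
         \<le> ereal \<epsilon>"
      using \<Gamma> h[OF i] dims[OF i] unfolding SUP_le_iff
      by (intro bexI[of _ \<Gamma>] exI[of _ "\<II> i"] exI[of _ "\<OO> i"]) (auto simp: U_def mult.assoc)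
  qed
  then show ?thesis unfolding approx_union_def by blast
qed

end
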